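(* Let $\bm G$ be the plant $\dot x=Ax+B_2u,\ y=C_2x$, with $(A,B_2)$ stabilizable and $(C_2,A)$ detectable. Let $$\bm C:\ \dot x_c=A_cx_c+B_cy,\ u_c=C_cx_c+D_cy,\qquad \bm K:\ \dot x_k=A_kx_k+B_ky,\ u_k=C_kx_k+D_ky$$ be two arbitrary stabilizing controllers for $\bm G$, and let $L$ and $L_c$ be any matrices such that $A+LC_2$ and $A_c+L_cC_c$ are both stable. Define $\bm Q:\ \dot x_q=A_qx_q+B_qf,\ u_q=C_qx_q+D_qf$ by $$A_q=\begin{bmatrix} A_c+L_cC_c & (B_c+L_cD_q)C_2 & -L_cC_k \\ 0 & A+B_2D_kC_2 & B_2C_k \\ 0 & B_kC_2 & A_k \end{bmatrix},\quad B_q=\begin{bmatrix} -B_c-L_cD_q \\ L-B_2D_k \\ -B_k \end{bmatrix},$$ $$C_q=\begin{bmatrix} -C_c & -D_qC_2 & C_k \end{bmatrix},\quad D_q=D_c-D_k .$$ Then $\bm Q$ is stable (i.e. $A_q$ is a stable matrix), and the composite controller $\bm{K_{CQ}}$ (with input $y$ and output $u$) given by $$\begin{aligned} \dot x_c&=(A_c+L_cC_c)x_c-L_cu+(B_c+L_cD_c)y,\\ u_c&=C_cx_c+D_cy,\\ \dot{\hat x}&=A\hat x+B_2u+Lf,\qquad f=C_2\hat x-y,\\ \dot x_q&=A_qx_q+B_qf,\qquad u_q=C_qx_q+D_qf,\\ u&=u_c+u_q \end{aligned}$$ stabilizes $\bm G$, and its transfer matrix from $y$ to $u$ satisfies $\bm{K_{CQ}}(s)=\bm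 K(s)$.
   Context: All matrices are real, constant, of compatible dimensions; $x\in\mathbb R^n$, $u\in\mathbb R^{m_2}$, $y\in\mathbb R^{p_2}$. A square matrix is called stable if all its eigenvalues have negative real part. A controller given in state space stabilizes $\bm G$ (is stabilizing) if the state matrix of the closed-loop interconnection of $\bm G$ and the controller (with $u$ equal to the controller output) is stable; e.g. for $\bm K$ this means $\begin{bmatrix} A+B_2D_kC_2 & B_2C_k \\ B_kC_2 & A_k \end{bmatrix}$ is stable, and similarly for $\bm C$. $\bm K(s)=C_k(sI-A_k)^{-1}B_k+D_k$ is the transfer matrix of $\bm K$. *)

theory Defs
  imports
    Complex_Main
    "Jordan_Normal_Form.Matrix"
    "Jordan_Normal_Form.Char_Poly"
    "Jordan_Normal_Form.Gauss_Jordan_Elimination"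
begin

abbreviation cmat :: "real mat \<Rightarrow> complex mat" where
  "cmat M \<equiv> map_mat complex_of_real M"

definition stable_mat :: "real mat \<Rightarrow> bool" where
  "stable_mat M \<longleftrightarrow> square_mat M \<and> (\<forall>z. eigenvalue (cmat M) z \<longrightarrow> Re z < 0)"

definition stabilizable :: "real mat \<Rightarrow> real mat \<Rightarrow> bool" where
  "stabilizable A B \<longleftrightarrow> (\<exists>F \<in> carrier_mat (dim_col B) (dim_row A). stable_mat (A + B * F))"

definition detectable :: "real mat \<Rightarrow> real mat \<Rightarrow> bool" where
  "detectable C A \<longleftrightarrow> (\<exists>L \<in> carrier_mat (dim_row A) (dim_row C). stable_mat (A + L * C))"

text \<open>A state-space system \<open>x' = A x + B v, w = C x + D v\<close>. Dimensions may be zero, so that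
  static controllers (no state) are included.\<close>

datatype system = System (sysA: "real mat") (sysB: "real mat") (sysC: "real mat") (sysD: "real mat")

text \<open>The value is meaningful only where \<open>s I - A\<close> is invertible, i.e. where \<open>s\<close> is not an
  eigenvalue of the state matrix.\<close>

definition transfer_mat :: "system \<Rightarrow> complex \<Rightarrow> complex mat" where
  "transfer_mat S s =
     cmat (sysC S)
       * the (mat_inverse (s \<cdot>\<^sub>m 1\<^sub>m (dim_row (sysA S)) - cmat (sysA S)))
       * cmat (sysB S)
     + cmat (sysD S)"

text \<open>State matrix of the interconnection of the plant \<open>x' = A x + B\<^sub>2 u, y = C\<^sub>2 x\<close>
  with a controller from \<open>y\<close> to \<open>u\<close> (positive feedback sign: \<open>u\<close> is the controller output).\<close>

definition closed_loop :: "real mat \<Rightarrow> real mat \<Rightarrow> real mat \<Rightarrow> system \<Rightarrow> real mat" where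
  "closed_loop A B2 C2 K =
     four_block_mat
       (A + B2 * sysD K * C2) (B2 * sysC K)
       (sysB K * C2)          (sysA K)"

definition stabilizes :: "real mat \<Rightarrow> real mat \<Rightarrow> real mat \<Rightarrow> system \<Rightarrow> bool" where
  "stabilizes A B2 C2 K \<longleftrightarrow> stable_mat (closed_loop A B2 C2 K)"

text \<open>Juxtaposition of two matrices with the same number of rows; the column counterpart of
  \<open>@\<^sub>r\<close>.\<close>

definition append_cols :: "real mat \<Rightarrow> real mat \<Rightarrow> real mat"  (infixr \<open>@\<^sub>c\<close> 65) where
  "X @\<^sub>c Y = four_block_mat X Y (0\<^sub>m 0 (dim_col X)) (0\<^sub>m 0 (dim_col Y))"

fun parameter_Q ::
  "real mat \<Rightarrow> real mat \<Rightarrow> real mat \<Rightarrow> real mat \<Rightarrow> real mat \<Rightarrow> system \<Rightarrow> system \<Rightarrow> system" where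
  "parameter_Q A B2 C2 L Lc (System Ac Bc Cc Dc) (System Ak Bk Ck Dk) =
    (let Dq = Dc - Dk in
     System
      (four_block_mat
        (Ac + Lc * Cc)
        (((Bc + Lc * Dq) * C2) @\<^sub>c (- (Lc * Ck)))
        (0\<^sub>m (dim_row A + dim_row Ak) (dim_row Ac))
        (four_block_mat
          (A + B2 * Dk * C2) (B2 * Ck)
          (Bk * C2)          Ak))
      ((- Bc - Lc * Dq) @\<^sub>r (L - B2 * Dk) @\<^sub>r (- Bk))
      ((- Cc) @\<^sub>c (- (Dq * C2)) @\<^sub>c Ck)
      Dq)"

text \<open>The composite controller has state \<open>(x\<^sub>c, xhat, x\<^sub>q)\<close>, input \<open>y\<close> and output \<open>u\<close>. Once
  \<open>f = C\<^sub>2 xhat - y\<close> is inserted, its equations read \<open>X' = A\<^sub>0 X + B\<^sub>u u + B\<^sub>y y\<close> and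
  \<open>u = C\<^sub>0 X + D\<^sub>0 y\<close>; inserting the second into the first gives the state-space form.
  Lemma \<open>composite_equations\<close> confirms that this form satisfies the original equations.\<close>

fun composite ::
  "real mat \<Rightarrow> real mat \<Rightarrow> real mat \<Rightarrow> real mat \<Rightarrow> real mat \<Rightarrow> system \<Rightarrow> system \<Rightarrow> system" where
  "composite A B2 C2 L Lc (System Ac Bc Cc Dc) (System Aq Bq Cq Dq) =
    (let n = dim_row A; nc = dim_row Ac; nq = dim_row Aq;
         A0 = four_block_mat
                (Ac + Lc * Cc)     (0\<^sub>m nc (n + nq))
                (0\<^sub>m (n + nq) nc)   (four_block_mat
                                      (A + L * C2) (0\<^sub>m n nq)
                                      (Bq * C2)    Aq);
         Bu = (- Lc) @\<^sub>r B2 @\<^sub>r 0\<^sub>m nq (dim_col B2);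
         By = (Bc + Lc * Dc) @\<^sub>r (- L) @\<^sub>r (- Bq);
         C0 = Cc @\<^sub>c (Dq * C2) @\<^sub>c Cq;
         D0 = Dc - Dq
     in System (A0 + Bu * C0) (By + Bu * D0) C0 D0)"

lemma append_cols_carrier [simp, intro]:
  "X \<in> carrier_mat r c1 \<Longrightarrow> Y \<in> carrier_mat r c2 \<Longrightarrow> X @\<^sub>c Y \<in> carrier_mat r (c1 + c2)"
  unfolding append_cols_def
  using four_block_carrier_mat[of X r c1 "0\<^sub>m 0 (dim_col Y)" 0 c2] by auto

lemma append_cols_mult_vec:
  assumes X: "X \<in> carrier_mat r c1" and Y: "Y \<in> carrier_mat r c2"
    and v: "v \<in> carrier_vec c1" and w: "w \<in> carrier_vec c2"
  shows "(X @\<^sub>c Y) *\<^sub>v (v @\<^sub>v w) = X *\<^sub>v v + Y *\<^sub>v w"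
proof -
  have "(X @\<^sub>c Y) *\<^sub>v (v @\<^sub>v w)
      = (X *\<^sub>v v + Y *\<^sub>v w) @\<^sub>v (0\<^sub>m 0 c1 *\<^sub>v v + 0\<^sub>m 0 c2 *\<^sub>v w)"
    unfolding append_cols_def using X Y v w
    by (subst four_block_mat_mult_vec[OF X Y _ _ v w]) auto
  also have "\<dots> = X *\<^sub>v v + Y *\<^sub>v w"
    by (rule eq_vecI) (use X Y v w in auto)
  finally show ?thesis .
qed

lemma uminus_mult_mat_vec_real:
  assumes "M \<in> carrier_mat r c" "v \<in> carrier_vec c"
  shows "(- M) *\<^sub>v v = - (M *\<^sub>v (v :: real vec))"
  using assms by (intro eq_vecI) (auto simp: scalar_prod_def sum_negf)

lemma composite_equations:
  fixes A B2 C2 L Lc Ac Bc Cc Dc Aq Bq Cq Dq :: "real mat" and xc xh xq y :: "real vec"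
  assumes c: "A \<in> carrier_mat n n" "B2 \<in> carrier_mat n m" "C2 \<in> carrier_mat p n"
    "L \<in> carrier_mat n p" "Lc \<in> carrier_mat nc m"
    "Ac \<in> carrier_mat nc nc" "Bc \<in> carrier_mat nc p" "Cc \<in> carrier_mat m nc" "Dc \<in> carrier_mat m p"
    "Aq \<in> carrier_mat nq nq" "Bq \<in> carrier_mat nq p" "Cq \<in> carrier_mat m nq" "Dq \<in> carrier_mat m p"
    and v: "xc \<in> carrier_vec nc" "xh \<in> carrier_vec n" "xq \<in> carrier_vec nq" "y \<in> carrier_vec p"
  defines "f \<equiv> C2 *\<^sub>v xh - y"
  defines "u \<equiv> (Cc *\<^sub>v xc + Dc *\<^sub>v y) + (Cq *\<^sub>v xq + Dq *\<^sub>v f)"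
  defines "S \<equiv> composite A B2 C2 L Lc (System Ac Bc Cc Dc) (System Aq Bq Cq Dq)"
  defines "X \<equiv> xc @\<^sub>v xh @\<^sub>v xq"
  shows "sysA S *\<^sub>v X + sysB S *\<^sub>v y =
      ((Ac + Lc * Cc) *\<^sub>v xc - Lc *\<^sub>v u + (Bc + Lc * Dc) *\<^sub>v y) @\<^sub>v
      (A *\<^sub>v xh + B2 *\<^sub>v u + L *\<^sub>v f) @\<^sub>v
      (Aq *\<^sub>v xq + Bq *\<^sub>v f)"
    and "sysC S *\<^sub>v X + sysD S *\<^sub>v y = u"
proof -
  define A0 where "A0 = four_block_mat (Ac + Lc * Cc) (0\<^sub>m nc (n + nq)) (0\<^sub>m (n + nq) nc)
      (four_block_mat (A + L * C2) (0\<^sub>m n nq) (Bq * C2) Aq)"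
  define Bu where "Bu = (- Lc) @\<^sub>r B2 @\<^sub>r 0\<^sub>m nq m"
  define By where "By = (Bc + Lc * Dc) @\<^sub>r (- L) @\<^sub>r (- Bq)"
  define C0 where "C0 = Cc @\<^sub>c (Dq * C2) @\<^sub>c Cq"
  define D0 where "D0 = Dc - Dq"
  have S: "S = System (A0 + Bu * C0) (By + Bu * D0) C0 D0"
    unfolding S_def A0_def Bu_def By_def C0_def D0_def using c by (simp add: Let_def)
  have cf: "f \<in> carrier_vec p" and cu: "u \<in> carrier_vec m"
    unfolding f_def u_def using c v by auto
  have cX: "X \<in> carrier_vec (nc + (n + nq))" unfolding X_def using v by auto
  have cA0: "A0 \<in> carrier_mat (nc + (n + nq)) (nc + (n + nq))"
    unfolding A0_def by (rule four_block_carrier_mat) (use c in auto)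
  have cBu: "Bu \<in> carrier_mat (nc + (n + nq)) m" unfolding Bu_def
    using c by (intro carrier_append_rows) auto
  have cBy: "By \<in> carrier_mat (nc + (n + nq)) p" unfolding By_def
    using c by (intro carrier_append_rows) auto
  have cC0: "C0 \<in> carrier_mat m (nc + (n + nq))" unfolding C0_def
    using c by (intro append_cols_carrier) auto
  have cD0: "D0 \<in> carrier_mat m p" unfolding D0_def using c by auto
  have C0X: "C0 *\<^sub>v X = Cc *\<^sub>v xc + ((Dq * C2) *\<^sub>v xh + Cq *\<^sub>v xq)"
    unfolding C0_def X_def using c v
    by (subst append_cols_mult_vec[where r = m and ?c1.0 = nc and ?c2.0 = "n + nq"];
        (subst append_cols_mult_vec[where r = m and ?c1.0 = n and ?c2.0 = nq])?) auto
  have Dqf: "Dq *\<^sub>v f = Dq *\<^sub>v (C2 *\<^sub>v xh) - Dq *\<^sub>v y"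
    unfolding f_def using c v by (intro mult_minus_distrib_mat_vec) auto
  have D0y: "D0 *\<^sub>v y = Dc *\<^sub>v y - Dq *\<^sub>v y"
    unfolding D0_def using c v by (intro minus_mult_distrib_mat_vec) auto
  have u: "C0 *\<^sub>v X + D0 *\<^sub>v y = u"
    unfolding C0X D0y u_def Dqf using c v
    by (subst assoc_mult_mat_vec[of Dq m p C2 n xh]; (intro eq_vecI)?) auto
  then show "sysC S *\<^sub>v X + sysD S *\<^sub>v y = u" unfolding S by simp
  have 1: "(A0 + Bu * C0) *\<^sub>v X = A0 *\<^sub>v X + Bu *\<^sub>v (C0 *\<^sub>v X)"
    using cA0 cBu cC0 cX by (simp add: add_mult_distrib_mat_vec[OF cA0 _ cX])
  have 2: "(By + Bu * D0) *\<^sub>v y = By *\<^sub>v y + Bu *\<^sub>v (D0 *\<^sub>v y)"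
    using cBy cBu cD0 v by (simp add: add_mult_distrib_mat_vec[OF cBy _ v(4)])
  have 3: "Bu *\<^sub>v u = Bu *\<^sub>v (C0 *\<^sub>v X) + Bu *\<^sub>v (D0 *\<^sub>v y)"
    unfolding u[symmetric] using cBu cC0 cX cD0 v
    by (intro mult_add_distrib_mat_vec) auto
  have Buu: "Bu *\<^sub>v u = (- (Lc *\<^sub>v u)) @\<^sub>v (B2 *\<^sub>v u) @\<^sub>v 0\<^sub>v nq"
    unfolding Bu_def using c cu
    by (subst mat_mult_append[where ?nr1.0 = nc and ?nr2.0 = "n + nq" and nc = m];
        (subst mat_mult_append[where ?nr1.0 = n and ?nr2.0 = nq and nc = m])?)
       (auto simp: uminus_mult_mat_vec_real)
  have Byy: "By *\<^sub>v y = ((Bc + Lc * Dc) *\<^sub>v y) @\<^sub>v (- (L *\<^sub>v y)) @\<^sub>v (- (Bq *\<^sub>v y))"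
    unfolding By_def using c v
    by (subst mat_mult_append[where ?nr1.0 = nc and ?nr2.0 = "n + nq" and nc = p];
        (subst mat_mult_append[where ?nr1.0 = n and ?nr2.0 = nq and nc = p])?)
       (auto simp: uminus_mult_mat_vec_real)
  have inner: "four_block_mat (A + L * C2) (0\<^sub>m n nq) (Bq * C2) Aq *\<^sub>v (xh @\<^sub>v xq)
      = ((A + L * C2) *\<^sub>v xh + 0\<^sub>m n nq *\<^sub>v xq) @\<^sub>v ((Bq * C2) *\<^sub>v xh + Aq *\<^sub>v xq)"
    by (rule four_block_mat_mult_vec) (use c v in auto)
  have A0X: "A0 *\<^sub>v X = ((Ac + Lc * Cc) *\<^sub>v xc + 0\<^sub>m nc (n + nq) *\<^sub>v (xh @\<^sub>v xq)) @\<^sub>v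
      (0\<^sub>m (n + nq) nc *\<^sub>v xc + (((A + L * C2) *\<^sub>v xh + 0\<^sub>m n nq *\<^sub>v xq) @\<^sub>v ((Bq * C2) *\<^sub>v xh + Aq *\<^sub>v xq)))"
    unfolding A0_def X_def inner[symmetric]
    by (rule four_block_mat_mult_vec[where ?nr1.0 = nc and ?nr2.0 = "n + nq"])
       (use c v in auto)
  have ALC: "(A + L * C2) *\<^sub>v xh = A *\<^sub>v xh + L *\<^sub>v (C2 *\<^sub>v xh)"
    using c v by (simp add: add_mult_distrib_mat_vec[OF c(1) _ v(2)])
  have BqC: "(Bq * C2) *\<^sub>v xh = Bq *\<^sub>v (C2 *\<^sub>v xh)" using c v by simp
  have Lf: "L *\<^sub>v f = L *\<^sub>v (C2 *\<^sub>v xh) - L *\<^sub>v y" "Bq *\<^sub>v f = Bq *\<^sub>v (C2 *\<^sub>v xh) - Bq *\<^sub>v y"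
    unfolding f_def using c v
    by (intro mult_minus_distrib_mat_vec; auto)+
  define a1 a2 a3 a4 a5 a6 a7 a8 a9 a10 where a:
    "a1 = (Ac + Lc * Cc) *\<^sub>v xc" "a2 = Lc *\<^sub>v u" "a3 = (Bc + Lc * Dc) *\<^sub>v y"
    "a4 = A *\<^sub>v xh" "a5 = B2 *\<^sub>v u" "a6 = L *\<^sub>v (C2 *\<^sub>v xh)" "a7 = L *\<^sub>v y"
    "a8 = Aq *\<^sub>v xq" "a9 = Bq *\<^sub>v (C2 *\<^sub>v xh)" "a10 = Bq *\<^sub>v y"
  have ca: "dim_vec a1 = nc" "dim_vec a2 = nc" "dim_vec a3 = nc" "dim_vec a4 = n" "dim_vec a5 = n"
    "dim_vec a6 = n" "dim_vec a7 = n" "dim_vec a8 = nq" "dim_vec a9 = nq" "dim_vec a10 = nq"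
    unfolding a using c v by auto
  have z: "0\<^sub>m nc (n + nq) *\<^sub>v (xh @\<^sub>v xq) = 0\<^sub>v nc" "0\<^sub>m (n + nq) nc *\<^sub>v xc = 0\<^sub>v (n + nq)"
    "0\<^sub>m n nq *\<^sub>v xq = 0\<^sub>v n" using v by auto
  have rearr: "sysA S *\<^sub>v X + sysB S *\<^sub>v y = A0 *\<^sub>v X + By *\<^sub>v y + Bu *\<^sub>v u"
    unfolding S system.sel 1 2 3 using cA0 cBu cBy cC0 cD0 by (intro eq_vecI) auto
  show "sysA S *\<^sub>v X + sysB S *\<^sub>v y =
      ((Ac + Lc * Cc) *\<^sub>v xc - Lc *\<^sub>v u + (Bc + Lc * Dc) *\<^sub>v y) @\<^sub>v
      (A *\<^sub>v xh + B2 *\<^sub>v u + L *\<^sub>v f) @\<^sub>v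
      (Aq *\<^sub>v xq + Bq *\<^sub>v f)"
    unfolding rearr A0X Byy Buu ALC BqC Lf z a[symmetric]
    by (intro eq_vecI) (auto simp: ca)
qed

end

theory Submission
  imports Defs
begin

text \<open>With \<open>(q\<^sub>1, q\<^sub>2, q\<^sub>3)\<close> the state of \<open>Q\<close>, the differences \<open>h = xhat - q\<^sub>2\<close> and
  \<open>z = x\<^sub>c - q\<^sub>1\<close> in the composite controller evolve autonomously, whatever its input \<open>y\<close>, as the loop
  of the plant with \<open>C\<close>. If they vanish, then \<open>q\<^sub>3\<close> and \<open>u\<close> follow the equations of \<open>K\<close> with
  input \<open>y\<close>. So an eigenvector of the composite loop for an eigenvalue with nonnegative real part is
  killed step by step by the stability of the loop with \<open>C\<close>, of the loop with \<open>K\<close>, of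
  \<open>A + L C\<^sub>2\<close> and of \<open>A\<^sub>c + L\<^sub>c C\<^sub>c\<close>; and the resolvent equation of the composite controller
  collapses to that of \<open>K\<close>.\<close>

subsection \<open>Block matrices acting on vectors\<close>

lemma add_mult_mat_vec:
  fixes M :: "'a :: comm_ring_1 mat"
  assumes "dim_row M = dim_row N" "dim_col M = dim_vec v" "dim_col N = dim_vec v"
  shows "(M + N) *\<^sub>v v = M *\<^sub>v v + N *\<^sub>v v"
  by (rule add_mult_distrib_mat_vec[of _ "dim_row M" "dim_vec v"])
     (use assms in \<open>auto intro!: carrier_matI\<close>)

lemma minus_mult_mat_vec:
  fixes M :: "'a :: comm_ring_1 mat"
  assumes "dim_row M = dim_row N" "dim_col M = dim_vec v" "dim_col N = dim_vec v"
  shows "(M - N) *\<^sub>v v = M *\<^sub>v v - N *\<^sub>v v"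
  by (rule minus_mult_distrib_mat_vec[of _ "dim_row M" "dim_vec v"])
     (use assms in \<open>auto intro!: carrier_matI\<close>)

lemma mult_mat_mult_vec:
  fixes M :: "'a :: comm_ring_1 mat"
  assumes "dim_col M = dim_row N" "dim_col N = dim_vec v"
  shows "(M * N) *\<^sub>v v = M *\<^sub>v (N *\<^sub>v v)"
  by (rule assoc_mult_mat_vec[of _ "dim_row M" "dim_row N" _ "dim_vec v"])
     (use assms in \<open>auto intro!: carrier_matI\<close>)

lemma mult_mat_add_vec:
  fixes M :: "'a :: comm_ring_1 mat"
  assumes "dim_vec v = dim_col M" "dim_vec w = dim_col M"
  shows "M *\<^sub>v (v + w) = M *\<^sub>v v + M *\<^sub>v w"
  by (rule mult_add_distrib_mat_vec[of _ "dim_row M" "dim_col M"])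
     (use assms in \<open>auto intro!: carrier_matI carrier_vecI\<close>)

lemma mult_mat_minus_vec:
  fixes M :: "'a :: comm_ring_1 mat"
  assumes "dim_vec v = dim_col M" "dim_vec w = dim_col M"
  shows "M *\<^sub>v (v - w) = M *\<^sub>v v - M *\<^sub>v w"
  by (rule mult_minus_distrib_mat_vec[of _ "dim_row M" "dim_col M"])
     (use assms in \<open>auto intro!: carrier_matI carrier_vecI\<close>)

lemma mult_mat_zero_vec [simp]:
  fixes M :: "'a :: comm_ring_1 mat"
  assumes "n = dim_col M"
  shows "M *\<^sub>v 0\<^sub>v n = 0\<^sub>v (dim_row M)"
  using assms by (intro eq_vecI) auto

lemma four_block_mult_append_vec:
  fixes A :: "'a :: comm_ring_1 mat"
  assumes "dim_row B = dim_row A" "dim_col C = dim_col A" "dim_row C = dim_row D"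
    "dim_col B = dim_col D" "dim_vec v = dim_col A" "dim_vec w = dim_col D"
  shows "four_block_mat A B C D *\<^sub>v (v @\<^sub>v w) = (A *\<^sub>v v + B *\<^sub>v w) @\<^sub>v (C *\<^sub>v v + D *\<^sub>v w)"
  by (rule four_block_mat_mult_vec[of _ "dim_row A" "dim_col A" _ "dim_col D" _ "dim_row D"])
     (use assms in \<open>auto intro!: carrier_matI carrier_vecI\<close>)

lemma append_rows_mult_vec:
  fixes M :: "'a :: comm_ring_1 mat"
  assumes "dim_col M = dim_vec v" "dim_col N = dim_vec v"
  shows "(M @\<^sub>r N) *\<^sub>v v = (M *\<^sub>v v) @\<^sub>v (N *\<^sub>v v)"
  by (rule mat_mult_append[of _ "dim_row M" "dim_vec v" _ "dim_row N"])
     (use assms in \<open>auto intro!: carrier_matI carrier_vecI\<close>)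

lemma append_cols_mult_append_vec:
  assumes "dim_row M = dim_row N" "dim_vec v = dim_col M" "dim_vec w = dim_col N"
  shows "(M @\<^sub>c N) *\<^sub>v (v @\<^sub>v w) = M *\<^sub>v v + N *\<^sub>v w"
  by (rule append_cols_mult_vec[of _ "dim_row M" "dim_col M" _ "dim_col N"])
     (use assms in \<open>auto intro!: carrier_matI carrier_vecI\<close>)

lemma dim_append_cols [simp]:
  "dim_row (M @\<^sub>c N) = dim_row M" "dim_col (M @\<^sub>c N) = dim_col M + dim_col N"
  by (simp_all add: append_cols_def)

lemma dim_append_rows [simp]:
  "dim_row (M @\<^sub>r N) = dim_row M + dim_row N" "dim_col (M @\<^sub>r N) = dim_col M"
  by (simp_all add: append_rows_def)

lemmas mat_vec_linear = add_mult_mat_vec minus_mult_mat_vec mult_mat_mult_vec mult_mat_add_vec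
  mult_mat_minus_vec four_block_mult_append_vec append_rows_mult_vec append_cols_mult_append_vec

lemma map_vec_append_vec [simp]: "map_vec f (v @\<^sub>v w) = map_vec f v @\<^sub>v map_vec f w"
  by (intro eq_vecI) auto

lemma map_vec_Re_Im_arith:
  fixes v w :: "complex vec"
  assumes "dim_vec v = dim_vec w"
  shows "map_vec Re (v + w) = map_vec Re v + map_vec Re w"
    and "map_vec Im (v + w) = map_vec Im v + map_vec Im w"
    and "map_vec Re (v - w) = map_vec Re v - map_vec Re w"
    and "map_vec Im (v - w) = map_vec Im v - map_vec Im w"
  using assms by (auto intro!: eq_vecI)

lemma map_vec_Re_Im_cmat_mult:
  assumes "dim_vec v = dim_col M"
  shows "map_vec Re (cmat M *\<^sub>v v) = M *\<^sub>v map_vec Re v"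
    and "map_vec Im (cmat M *\<^sub>v v) = M *\<^sub>v map_vec Im v"
  using assms by (auto intro!: eq_vecI simp: scalar_prod_def)

lemmas map_vec_Re_Im = map_vec_Re_Im_arith map_vec_Re_Im_cmat_mult

lemma complex_vec_eqI:
  assumes "map_vec Re v = map_vec Re w" "map_vec Im v = map_vec Im w"
  shows "v = w"
proof (rule eq_vecI)
  show "dim_vec v = dim_vec w" using arg_cong[OF assms(1), of dim_vec] by simp
  then show "v $ i = w $ i" if "i < dim_vec w" for i
    using that arg_cong[OF assms(1), of "\<lambda>u. u $ i"] arg_cong[OF assms(2), of "\<lambda>u. u $ i"]
    by (simp add: complex_eq_iff)
qed

lemma eq_mat_mult_vecI:
  fixes M N :: "'a :: comm_ring_1 mat"
  assumes "M \<in> carrier_mat nr nc" "N \<in> carrier_mat nr nc"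
    and "\<And>v. v \<in> carrier_vec nc \<Longrightarrow> M *\<^sub>v v = N *\<^sub>v v"
  shows "M = N"
proof (rule eq_matI)
  fix i j assume ij: "i < dim_row N" "j < dim_col N"
  have "(M *\<^sub>v unit_vec nc j) $ i = (N *\<^sub>v unit_vec nc j) $ i" using assms(3) by simp
  then show "M $$ (i, j) = N $$ (i, j)"
    using ij assms(1,2) by (simp add: scalar_prod_right_unit)
qed (use assms in auto)

lemma carrier_vec_splitE:
  assumes "v \<in> carrier_vec (a + b)"
  obtains x y where "x \<in> carrier_vec a" "y \<in> carrier_vec b" "v = x @\<^sub>v y"
  using assms by (metis vec_first_carrier vec_last_carrier vec_first_last_append)

lemma smult_append_vec: "s \<cdot>\<^sub>v (v @\<^sub>v w) = (s \<cdot>\<^sub>v v) @\<^sub>v (s \<cdot>\<^sub>v w)"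
  by (intro eq_vecI) auto

lemma smult_minus_vec:
  fixes v w :: "'a :: comm_ring_1 vec"
  assumes "dim_vec v = dim_vec w"
  shows "s \<cdot>\<^sub>v (v - w) = s \<cdot>\<^sub>v v - s \<cdot>\<^sub>v w"
  using assms by (intro eq_vecI) (auto simp: right_diff_distrib)

lemma append_vec_eqD:
  assumes "v @\<^sub>v w = v' @\<^sub>v w'" "dim_vec v = dim_vec v'"
  shows "v = v'" "w = w'"
  using iffD1[OF append_vec_eq[OF carrier_vecI[OF refl] carrier_vecI[OF assms(2)[symmetric]]] assms(1)]
  by blast+

lemma zero_append_zero_vec: "0\<^sub>v a @\<^sub>v 0\<^sub>v b = 0\<^sub>v (a + b)"
  by (intro eq_vecI) auto

lemma cmat_add_mult_mult_vec:
  assumes "M \<in> carrier_mat r c" "N \<in> carrier_mat r k" "P \<in> carrier_mat k c" "v \<in> carrier_vec c"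
  shows "cmat (M + N * P) *\<^sub>v v = cmat M *\<^sub>v v + cmat N *\<^sub>v (cmat P *\<^sub>v v)"
  using assms(4) assms(1-3)[THEN carrier_matD(1)] assms(1-3)[THEN carrier_matD(2)]
  by (intro complex_vec_eqI) (simp_all add: map_vec_Re_Im mat_vec_linear)

lemma zero_mat_mult_vec:
  fixes v :: "'a :: comm_ring_1 vec"
  shows "dim_vec v = c \<Longrightarrow> 0\<^sub>m r c *\<^sub>v v = 0\<^sub>v r"
  by (intro eq_vecI) auto

subsection \<open>Stability, resolvents and transfer matrices\<close>

lemma four_block_mat_carrier:
  assumes "A \<in> carrier_mat n n" "D \<in> carrier_mat k k"
  shows "four_block_mat A B C D \<in> carrier_mat (n + k) (n + k)"
  using assms by simp

lemma stable_mat_eigenvector_zero: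
  assumes "stable_mat M" "M \<in> carrier_mat n n" "v \<in> carrier_vec n"
    and "cmat M *\<^sub>v v = s \<cdot>\<^sub>v v" "0 \<le> Re s"
  shows "v = 0\<^sub>v n"
proof (rule ccontr)
  assume "v \<noteq> 0\<^sub>v n"
  then have "eigenvalue (cmat M) s"
    unfolding eigenvalue_def eigenvector_def using assms by auto
  then show False using assms(1,5) unfolding stable_mat_def by force
qed

lemma stable_matI:
  assumes "M \<in> carrier_mat n n"
    and "\<And>s v. \<lbrakk>v \<in> carrier_vec n; cmat M *\<^sub>v v = s \<cdot>\<^sub>v v; 0 \<le> Re s\<rbrakk> \<Longrightarrow> v = 0\<^sub>v n"
  shows "stable_mat M"
  using assms unfolding stable_mat_def eigenvalue_def eigenvector_def by force

lemma minus_vec_eqD: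
  fixes a b c :: "'a :: ab_group_add vec"
  assumes "a - b = c" "dim_vec a = dim_vec b"
  shows "a = b + c"
  unfolding assms(1)[symmetric] using assms(2) by (intro eq_vecI) auto

lemma resolvent_carrier [simp]:
  "M \<in> carrier_mat n n \<Longrightarrow> s \<cdot>\<^sub>m 1\<^sub>m n - M \<in> carrier_mat n n"
  by (simp add: minus_carrier_mat)

lemma resolvent_mult_vec:
  fixes M :: "'a :: comm_ring_1 mat"
  assumes "M \<in> carrier_mat n n" "v \<in> carrier_vec n"
  shows "(s \<cdot>\<^sub>m 1\<^sub>m n - M) *\<^sub>v v = s \<cdot>\<^sub>v v - M *\<^sub>v v"
  using assms by (intro eq_vecI) (auto simp: minus_mult_mat_vec)

lemma resolvent_inverse:
  fixes M :: "'a :: field mat"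
  assumes M: "M \<in> carrier_mat n n" and s: "\<not> eigenvalue M s"
  obtains R where "mat_inverse (s \<cdot>\<^sub>m 1\<^sub>m n - M) = Some R" "R \<in> carrier_mat n n"
    "(s \<cdot>\<^sub>m 1\<^sub>m n - M) * R = 1\<^sub>m n" "R * (s \<cdot>\<^sub>m 1\<^sub>m n - M) = 1\<^sub>m n"
proof -
  let ?S = "s \<cdot>\<^sub>m 1\<^sub>m n - M"
  have S: "?S \<in> carrier_mat n n" using M by simp
  have "det ?S \<noteq> 0"
  proof
    assume "det ?S = 0"
    then obtain v where v: "v \<in> carrier_vec n" "v \<noteq> 0\<^sub>v n" "?S *\<^sub>v v = 0\<^sub>v n"
      using det_0_iff_vec_prod_zero[OF S] by auto
    have "?S *\<^sub>v v = s \<cdot>\<^sub>v v - M *\<^sub>v v"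
      by (rule resolvent_mult_vec[OF M v(1)])
    then have eq: "s \<cdot>\<^sub>v v - M *\<^sub>v v = 0\<^sub>v n" using v by simp
    have "M *\<^sub>v v = s \<cdot>\<^sub>v v"
    proof (rule eq_vecI)
      fix i assume "i < dim_vec (s \<cdot>\<^sub>v v)"
      then show "(M *\<^sub>v v) $ i = (s \<cdot>\<^sub>v v) $ i"
        using arg_cong[OF eq, of "\<lambda>u. u $ i"] M v(1) by auto
    qed (use M v in auto)
    then have "eigenvalue M s"
      unfolding eigenvalue_def eigenvector_def using M v by auto
    then show False using s by simp
  qed
  then have "?S \<in> Units (ring_mat TYPE('a) n ())"
    by (rule det_non_zero_imp_unit[OF S])
  then obtain R where R: "mat_inverse ?S = Some R"
    using mat_inverse(1)[OF S, where b = "()"] by (cases "mat_inverse ?S") auto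
  show thesis using that[OF R] mat_inverse(2)[OF S R] by blast
qed

lemma resolvent_solution:
  fixes M :: "'a :: field mat"
  assumes M: "M \<in> carrier_mat n n" and s: "\<not> eigenvalue M s" and r: "r \<in> carrier_vec n"
  obtains v where "v \<in> carrier_vec n" "s \<cdot>\<^sub>v v = M *\<^sub>v v + r"
proof -
  obtain R where R: "R \<in> carrier_mat n n" "(s \<cdot>\<^sub>m 1\<^sub>m n - M) * R = 1\<^sub>m n"
    using resolvent_inverse[OF M s] by metis
  let ?v = "R *\<^sub>v r"
  have v: "?v \<in> carrier_vec n" using R r by simp
  have "r = ((s \<cdot>\<^sub>m 1\<^sub>m n - M) * R) *\<^sub>v r" using R r by simp
  also have "\<dots> = (s \<cdot>\<^sub>m 1\<^sub>m n - M) *\<^sub>v ?v"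
    using R(1) M r by (subst mult_mat_mult_vec) auto
  also have "\<dots> = s \<cdot>\<^sub>v ?v - M *\<^sub>v ?v" by (rule resolvent_mult_vec[OF M v])
  finally have "s \<cdot>\<^sub>v ?v - M *\<^sub>v ?v = r" ..
  then have "s \<cdot>\<^sub>v ?v = M *\<^sub>v ?v + r"
    using M R by (intro minus_vec_eqD) auto
  with v that show thesis by blast
qed

lemma not_eigenvalueI:
  fixes M :: "'a :: field mat"
  assumes M: "M \<in> carrier_mat n n"
    and surj: "\<And>r. r \<in> carrier_vec n \<Longrightarrow> \<exists>v \<in> carrier_vec n. s \<cdot>\<^sub>v v = M *\<^sub>v v + r"
  shows "\<not> eigenvalue M s"
proof -
  let ?S = "s \<cdot>\<^sub>m 1\<^sub>m n - M"
  have S: "?S \<in> carrier_mat n n" using M by simp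
  have "\<forall>r \<in> carrier_vec n. \<exists>v \<in> carrier_vec n. ?S *\<^sub>v v = r"
  proof
    fix r :: "'a vec" assume r: "r \<in> carrier_vec n"
    obtain v where v: "v \<in> carrier_vec n" "s \<cdot>\<^sub>v v = M *\<^sub>v v + r" using surj[OF r] by blast
    have "?S *\<^sub>v v = s \<cdot>\<^sub>v v - M *\<^sub>v v" by (rule resolvent_mult_vec[OF M v(1)])
    also have "\<dots> = r" unfolding v(2) using M r by (intro eq_vecI) auto
    finally show "\<exists>v \<in> carrier_vec n. ?S *\<^sub>v v = r" using v by blast
  qed
  then obtain V where V: "\<And>r. r \<in> carrier_vec n \<Longrightarrow> V r \<in> carrier_vec n \<and> ?S *\<^sub>v V r = r"
    by metis
  define R where "R = mat_of_cols n (map (\<lambda>j. V (unit_vec n j)) [0..<n])"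
  have R: "R \<in> carrier_mat n n"
    unfolding R_def
    using mat_of_cols_carrier(1)[of n "map (\<lambda>j. V (unit_vec n j)) [0..<n]"]
    by simp
  have "?S * R = 1\<^sub>m n"
  proof (rule mat_col_eqI)
    fix j assume "j < dim_col (1\<^sub>m n :: 'a mat)"
    then have j: "j < n" by simp
    have "col (?S * R) j = ?S *\<^sub>v col R j" using S R j by (intro col_mult2) auto
    also have "col R j = V (unit_vec n j)"
      unfolding R_def using j V[of "unit_vec n j"] by (subst col_mat_of_cols) auto
    finally show "col (?S * R) j = col (1\<^sub>m n) j" using V[of "unit_vec n j"] j by simp
  qed (use S R in auto)
  then have "det ?S * det R = 1" using det_mult[OF S R] by simp
  then have d: "det ?S \<noteq> 0" by auto
  show ?thesis
  proof
    assume "eigenvalue M s"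
    then obtain v where v: "v \<in> carrier_vec n" "v \<noteq> 0\<^sub>v n" "M *\<^sub>v v = s \<cdot>\<^sub>v v"
      unfolding eigenvalue_def eigenvector_def using M by auto
    have "?S *\<^sub>v v = s \<cdot>\<^sub>v v - M *\<^sub>v v" by (rule resolvent_mult_vec[OF M v(1)])
    also have "\<dots> = 0\<^sub>v n" using v by (intro eq_vecI) auto
    finally show False using det_0_iff_vec_prod_zero[OF S] v d by blast
  qed
qed

lemma transfer_mat_carrier:
  assumes "sysA S \<in> carrier_mat k k" "sysB S \<in> carrier_mat k p"
    "sysC S \<in> carrier_mat m k" "sysD S \<in> carrier_mat m p"
  shows "transfer_mat S s \<in> carrier_mat m p"
  using assms unfolding transfer_mat_def by auto

lemma transfer_mat_mult_vec:
  assumes c: "sysA S \<in> carrier_mat k k" "sysB S \<in> carrier_mat k p"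
      "sysC S \<in> carrier_mat m k" "sysD S \<in> carrier_mat m p"
    and s: "\<not> eigenvalue (cmat (sysA S)) s"
    and v: "x \<in> carrier_vec k" "y \<in> carrier_vec p"
    and x: "s \<cdot>\<^sub>v x = cmat (sysA S) *\<^sub>v x + cmat (sysB S) *\<^sub>v y"
  shows "transfer_mat S s *\<^sub>v y = cmat (sysC S) *\<^sub>v x + cmat (sysD S) *\<^sub>v y"
proof -
  let ?S = "s \<cdot>\<^sub>m 1\<^sub>m k - cmat (sysA S)"
  obtain R where R: "mat_inverse ?S = Some R" "R \<in> carrier_mat k k" "R * ?S = 1\<^sub>m k"
    using resolvent_inverse[OF _ s] c by (metis map_carrier_mat)
  have "?S *\<^sub>v x = s \<cdot>\<^sub>v x - cmat (sysA S) *\<^sub>v x"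
    using c v by (intro resolvent_mult_vec) auto
  also have "\<dots> = cmat (sysB S) *\<^sub>v y" unfolding x using c v by (intro eq_vecI) auto
  finally have "R *\<^sub>v (cmat (sysB S) *\<^sub>v y) = R *\<^sub>v (?S *\<^sub>v x)" by simp
  also have "\<dots> = (R * ?S) *\<^sub>v x" using R(2) c v by (subst mult_mat_mult_vec) auto
  also have "\<dots> = x" using R(3) v by simp
  finally have "R *\<^sub>v (cmat (sysB S) *\<^sub>v y) = x" .
  then show ?thesis
    unfolding transfer_mat_def using c v R
    by (simp add: add_mult_mat_vec mult_mat_mult_vec)
qed

lemma closed_loop_carrier:
  assumes "A \<in> carrier_mat n n" "B2 \<in> carrier_mat n m" "C2 \<in> carrier_mat p n"
    and "sysA S \<in> carrier_mat k k"
  shows "closed_loop A B2 C2 S \<in> carrier_mat (n + k) (n + k)"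
  unfolding closed_loop_def by (rule four_block_mat_carrier) (use assms in auto)

lemma closed_loop_mult_vec:
  assumes c: "A \<in> carrier_mat n n" "B2 \<in> carrier_mat n m" "C2 \<in> carrier_mat p n"
    "sysA S \<in> carrier_mat k k" "sysB S \<in> carrier_mat k p"
    "sysC S \<in> carrier_mat m k" "sysD S \<in> carrier_mat m p"
    and v: "x \<in> carrier_vec n" "w \<in> carrier_vec k"
    and y: "y = cmat C2 *\<^sub>v x"
  shows "cmat (closed_loop A B2 C2 S) *\<^sub>v (x @\<^sub>v w) =
    (cmat A *\<^sub>v x + cmat B2 *\<^sub>v (cmat (sysC S) *\<^sub>v w + cmat (sysD S) *\<^sub>v y)) @\<^sub>v
    (cmat (sysA S) *\<^sub>v w + cmat (sysB S) *\<^sub>v y)"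
proof -
  have "closed_loop A B2 C2 S *\<^sub>v (a @\<^sub>v b) =
      (A *\<^sub>v a + B2 *\<^sub>v (sysC S *\<^sub>v b + sysD S *\<^sub>v (C2 *\<^sub>v a))) @\<^sub>v
      (sysA S *\<^sub>v b + sysB S *\<^sub>v (C2 *\<^sub>v a))"
    if "a \<in> carrier_vec n" "b \<in> carrier_vec k" for a b
    unfolding closed_loop_def using c that
    by (intro eq_vecI) (auto simp: mat_vec_linear)
  then show ?thesis
    unfolding y using c v closed_loop_carrier[OF c(1-4)]
    by (intro complex_vec_eqI) (simp_all add: map_vec_Re_Im)
qed

lemma stable_four_block_upper:
  assumes "stable_mat M" "M \<in> carrier_mat a a" "stable_mat N" "N \<in> carrier_mat b b"
    and E: "E \<in> carrier_mat a b"
  shows "stable_mat (four_block_mat M E (0\<^sub>m b a) N)" (is "stable_mat ?F")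
proof (rule stable_matI)
  show "?F \<in> carrier_mat (a + b) (a + b)" using assms by simp
  fix s v assume "v \<in> carrier_vec (a + b)" and eq: "cmat ?F *\<^sub>v v = s \<cdot>\<^sub>v v" and s: "0 \<le> Re s"
  then obtain x y where v: "x \<in> carrier_vec a" "y \<in> carrier_vec b" "v = x @\<^sub>v y"
    by (elim carrier_vec_splitE)
  have "cmat ?F *\<^sub>v v = (cmat M *\<^sub>v x + cmat E *\<^sub>v y) @\<^sub>v (cmat N *\<^sub>v y)"
    using assms v
    by (intro complex_vec_eqI) (simp_all add: map_vec_Re_Im mat_vec_linear zero_mat_mult_vec)
  then have eqs: "(cmat M *\<^sub>v x + cmat E *\<^sub>v y) @\<^sub>v (cmat N *\<^sub>v y) = (s \<cdot>\<^sub>v x) @\<^sub>v (s \<cdot>\<^sub>v y)"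
    using eq v by (simp add: smult_append_vec)
  have "cmat M *\<^sub>v x + cmat E *\<^sub>v y = s \<cdot>\<^sub>v x" "cmat N *\<^sub>v y = s \<cdot>\<^sub>v y"
    using append_vec_eqD[OF eqs] assms v by auto
  then have y: "y = 0\<^sub>v b" and x: "cmat M *\<^sub>v x + cmat E *\<^sub>v y = s \<cdot>\<^sub>v x"
    using stable_mat_eigenvector_zero[OF assms(3,4) v(2) _ s] by auto
  have "cmat M *\<^sub>v x = s \<cdot>\<^sub>v x" using x E assms(2) v(1) unfolding y by simp
  then have "x = 0\<^sub>v a" using stable_mat_eigenvector_zero[OF assms(1,2) v(1) _ s] by auto
  then show "v = 0\<^sub>v (a + b)" unfolding v(3) y by (simp add: zero_append_zero_vec)
qed

subsection \<open>The composite controller\<close>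

locale two_controllers =
  fixes n m p nc nk :: nat
    and A B2 C2 L Lc Ac Bc Cc Dc Ak Bk Ck Dk :: "real mat"
  assumes plant: "A \<in> carrier_mat n n" "B2 \<in> carrier_mat n m" "C2 \<in> carrier_mat p n"
    and gains: "L \<in> carrier_mat n p" "Lc \<in> carrier_mat nc m"
    and ctrl_C: "Ac \<in> carrier_mat nc nc" "Bc \<in> carrier_mat nc p"
      "Cc \<in> carrier_mat m nc" "Dc \<in> carrier_mat m p"
    and ctrl_K: "Ak \<in> carrier_mat nk nk" "Bk \<in> carrier_mat nk p"
      "Ck \<in> carrier_mat m nk" "Dk \<in> carrier_mat m p"
begin

abbreviation C :: system where "C \<equiv> System Ac Bc Cc Dc"
abbreviation K :: system where "K \<equiv> System Ak Bk Ck Dk"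
abbreviation Q :: system where "Q \<equiv> parameter_Q A B2 C2 L Lc C K"
abbreviation KCQ :: system where "KCQ \<equiv> composite A B2 C2 L Lc C Q"

lemmas carriers = plant gains ctrl_C ctrl_K
lemmas dims = carriers[THEN carrier_matD(1)] carriers[THEN carrier_matD(2)]

lemma Q_carriers:
  "sysA Q \<in> carrier_mat (nc + (n + nk)) (nc + (n + nk))" "sysB Q \<in> carrier_mat (nc + (n + nk)) p"
  "sysC Q \<in> carrier_mat m (nc + (n + nk))" "sysD Q \<in> carrier_mat m p"
  by (rule carrier_matI; simp add: Let_def dims)+

lemma KCQ_system_collapse: "KCQ = composite A B2 C2 L Lc C (System (sysA Q) (sysB Q) (sysC Q) (sysD Q))"
  by simp

lemma composite_carriers:
  assumes "Aq \<in> carrier_mat nq nq" "Bq \<in> carrier_mat nq p" "Cq \<in> carrier_mat m nq" "Dq \<in> carrier_mat m p"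
  defines "S \<equiv> composite A B2 C2 L Lc C (System Aq Bq Cq Dq)"
  shows "sysA S \<in> carrier_mat (nc + (n + nq)) (nc + (n + nq))" "sysB S \<in> carrier_mat (nc + (n + nq)) p"
    "sysC S \<in> carrier_mat m (nc + (n + nq))" "sysD S \<in> carrier_mat m p"
  unfolding S_def
  by (rule carrier_matI; simp add: Let_def dims assms(1-4)[THEN carrier_matD(1)]
        assms(1-4)[THEN carrier_matD(2)])+

lemmas KCQ_carriers = composite_carriers[OF Q_carriers, folded KCQ_system_collapse]
lemmas KCQ_dims = KCQ_carriers[THEN carrier_matD(1)] KCQ_carriers[THEN carrier_matD(2)]

lemma Q_equations:
  fixes q1 q2 q3 f :: "real vec"
  assumes v: "q1 \<in> carrier_vec nc" "q2 \<in> carrier_vec n" "q3 \<in> carrier_vec nk" "f \<in> carrier_vec p"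
    and g: "g = C2 *\<^sub>v q2 - f" and k: "k = Ck *\<^sub>v q3 + Dk *\<^sub>v g"
  shows "sysA Q *\<^sub>v (q1 @\<^sub>v q2 @\<^sub>v q3) + sysB Q *\<^sub>v f =
      (Ac *\<^sub>v q1 + Bc *\<^sub>v g - Lc *\<^sub>v (k - Cc *\<^sub>v q1 - Dc *\<^sub>v g)) @\<^sub>v
      (A *\<^sub>v q2 + B2 *\<^sub>v k + L *\<^sub>v f) @\<^sub>v
      (Ak *\<^sub>v q3 + Bk *\<^sub>v g)"
    and "sysC Q *\<^sub>v (q1 @\<^sub>v q2 @\<^sub>v q3) + sysD Q *\<^sub>v f = k - Cc *\<^sub>v q1 - Dc *\<^sub>v g"
  unfolding k g using carriers v
  by (intro eq_vecI; auto simp: Let_def mat_vec_linear)+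

lemma KCQ_equations:
  fixes xc xh q1 q2 q3 y :: "complex vec"
  assumes v: "xc \<in> carrier_vec nc" "xh \<in> carrier_vec n"
      "q1 \<in> carrier_vec nc" "q2 \<in> carrier_vec n" "q3 \<in> carrier_vec nk" "y \<in> carrier_vec p"
    and f: "f = cmat C2 *\<^sub>v xh - y" and g: "g = cmat C2 *\<^sub>v q2 - f"
    and k: "k = cmat Ck *\<^sub>v q3 + cmat Dk *\<^sub>v g"
    and u: "u = (cmat Cc *\<^sub>v xc + cmat Dc *\<^sub>v y) + (k - cmat Cc *\<^sub>v q1 - cmat Dc *\<^sub>v g)"
  shows "cmat (sysA KCQ) *\<^sub>v (xc @\<^sub>v xh @\<^sub>v q1 @\<^sub>v q2 @\<^sub>v q3) + cmat (sysB KCQ) *\<^sub>v y =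
      (cmat Ac *\<^sub>v xc + cmat Bc *\<^sub>v y + cmat Lc *\<^sub>v (cmat Cc *\<^sub>v xc + cmat Dc *\<^sub>v y - u)) @\<^sub>v
      (cmat A *\<^sub>v xh + cmat B2 *\<^sub>v u + cmat L *\<^sub>v f) @\<^sub>v
      (cmat Ac *\<^sub>v q1 + cmat Bc *\<^sub>v g - cmat Lc *\<^sub>v (k - cmat Cc *\<^sub>v q1 - cmat Dc *\<^sub>v g)) @\<^sub>v
      (cmat A *\<^sub>v q2 + cmat B2 *\<^sub>v k + cmat L *\<^sub>v f) @\<^sub>v
      (cmat Ak *\<^sub>v q3 + cmat Bk *\<^sub>v g)" (is ?state)
    and "cmat (sysC KCQ) *\<^sub>v (xc @\<^sub>v xh @\<^sub>v q1 @\<^sub>v q2 @\<^sub>v q3) + cmat (sysD KCQ) *\<^sub>v y = u" (is ?out)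
proof -
  have state: "sysA KCQ *\<^sub>v (xc @\<^sub>v xh @\<^sub>v q1 @\<^sub>v q2 @\<^sub>v q3) + sysB KCQ *\<^sub>v y =
      (Ac *\<^sub>v xc + Bc *\<^sub>v y + Lc *\<^sub>v (Cc *\<^sub>v xc + Dc *\<^sub>v y - u)) @\<^sub>v
      (A *\<^sub>v xh + B2 *\<^sub>v u + L *\<^sub>v f) @\<^sub>v
      (Ac *\<^sub>v q1 + Bc *\<^sub>v g - Lc *\<^sub>v (k - Cc *\<^sub>v q1 - Dc *\<^sub>v g)) @\<^sub>v
      (A *\<^sub>v q2 + B2 *\<^sub>v k + L *\<^sub>v f) @\<^sub>v
      (Ak *\<^sub>v q3 + Bk *\<^sub>v g)"
    and out: "sysC KCQ *\<^sub>v (xc @\<^sub>v xh @\<^sub>v q1 @\<^sub>v q2 @\<^sub>v q3) + sysD KCQ *\<^sub>v y = u"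
    if v: "xc \<in> carrier_vec nc" "xh \<in> carrier_vec n"
      "q1 \<in> carrier_vec nc" "q2 \<in> carrier_vec n" "q3 \<in> carrier_vec nk" "y \<in> carrier_vec p"
    and f: "f = C2 *\<^sub>v xh - y" and g: "g = C2 *\<^sub>v q2 - f"
    and k: "k = Ck *\<^sub>v q3 + Dk *\<^sub>v g"
    and u: "u = (Cc *\<^sub>v xc + Dc *\<^sub>v y) + (k - Cc *\<^sub>v q1 - Dc *\<^sub>v g)"
    for xc xh q1 q2 q3 y f g k u :: "real vec"
  proof -
    have cf: "f \<in> carrier_vec p" and cu: "u \<in> carrier_vec m"
      unfolding f g k u using carriers v by auto
    note Qeq = Q_equations[OF v(3-5) cf g k]
    have cq: "q1 @\<^sub>v q2 @\<^sub>v q3 \<in> carrier_vec (nc + (n + nk))" using v by simp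
    note eqs = composite_equations[OF plant gains ctrl_C Q_carriers v(1,2) cq v(6),
        folded KCQ_system_collapse f, unfolded Qeq, folded u]
    show "sysC KCQ *\<^sub>v (xc @\<^sub>v xh @\<^sub>v q1 @\<^sub>v q2 @\<^sub>v q3) + sysD KCQ *\<^sub>v y = u"
      by (rule eqs(2))
    have 1: "(Ac + Lc * Cc) *\<^sub>v xc - Lc *\<^sub>v u + (Bc + Lc * Dc) *\<^sub>v y =
      Ac *\<^sub>v xc + Bc *\<^sub>v y + Lc *\<^sub>v (Cc *\<^sub>v xc + Dc *\<^sub>v y - u)"
      using v cu by (intro eq_vecI) (simp_all add: mat_vec_linear dims)
    show "sysA KCQ *\<^sub>v (xc @\<^sub>v xh @\<^sub>v q1 @\<^sub>v q2 @\<^sub>v q3) + sysB KCQ *\<^sub>v y =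
      (Ac *\<^sub>v xc + Bc *\<^sub>v y + Lc *\<^sub>v (Cc *\<^sub>v xc + Dc *\<^sub>v y - u)) @\<^sub>v
      (A *\<^sub>v xh + B2 *\<^sub>v u + L *\<^sub>v f) @\<^sub>v
      (Ac *\<^sub>v q1 + Bc *\<^sub>v g - Lc *\<^sub>v (k - Cc *\<^sub>v q1 - Dc *\<^sub>v g)) @\<^sub>v
      (A *\<^sub>v q2 + B2 *\<^sub>v k + L *\<^sub>v f) @\<^sub>v
      (Ak *\<^sub>v q3 + Bk *\<^sub>v g)"
      using eqs(1) unfolding 1 .
  qed
  have fdims: "dim_vec f = p" "dim_vec g = p" "dim_vec k = m" "dim_vec u = m"
    unfolding f g k u using carriers v by auto
  let ?R = "map_vec Re" and ?I = "map_vec Im"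
  have R: "?R f = C2 *\<^sub>v ?R xh - ?R y" "?R g = C2 *\<^sub>v ?R q2 - ?R f"
      "?R k = Ck *\<^sub>v ?R q3 + Dk *\<^sub>v ?R g"
      "?R u = (Cc *\<^sub>v ?R xc + Dc *\<^sub>v ?R y) + (?R k - Cc *\<^sub>v ?R q1 - Dc *\<^sub>v ?R g)"
    and I: "?I f = C2 *\<^sub>v ?I xh - ?I y" "?I g = C2 *\<^sub>v ?I q2 - ?I f"
      "?I k = Ck *\<^sub>v ?I q3 + Dk *\<^sub>v ?I g"
      "?I u = (Cc *\<^sub>v ?I xc + Dc *\<^sub>v ?I y) + (?I k - Cc *\<^sub>v ?I q1 - Dc *\<^sub>v ?I g)"
    using carriers v fdims
    by (simp_all add: arg_cong[OF f, of ?R] arg_cong[OF g, of ?R] arg_cong[OF k, of ?R]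
        arg_cong[OF u, of ?R] arg_cong[OF f, of ?I] arg_cong[OF g, of ?I]
        arg_cong[OF k, of ?I] arg_cong[OF u, of ?I] map_vec_Re_Im)
  have vR: "?R xc \<in> carrier_vec nc" "?R xh \<in> carrier_vec n" "?R q1 \<in> carrier_vec nc"
      "?R q2 \<in> carrier_vec n" "?R q3 \<in> carrier_vec nk" "?R y \<in> carrier_vec p"
    and vI: "?I xc \<in> carrier_vec nc" "?I xh \<in> carrier_vec n" "?I q1 \<in> carrier_vec nc"
      "?I q2 \<in> carrier_vec n" "?I q3 \<in> carrier_vec nk" "?I y \<in> carrier_vec p"
    using v by simp_all
  show ?state
    using v by (intro complex_vec_eqI) (simp_all add: map_vec_Re_Im dims KCQ_dims fdims
        state[OF vR R] state[OF vI I] del: composite.simps parameter_Q.simps)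
  show ?out
    using v by (intro complex_vec_eqI) (simp_all add: map_vec_Re_Im dims KCQ_dims fdims
        out[OF vR R] out[OF vI I] del: composite.simps parameter_Q.simps)
qed

lemma Q_stable:
  assumes "stable_mat (Ac + Lc * Cc)" "stabilizes A B2 C2 K"
  shows "stable_mat (sysA Q)"
proof -
  have "sysA Q = four_block_mat (Ac + Lc * Cc) (((Bc + Lc * (Dc - Dk)) * C2) @\<^sub>c (- (Lc * Ck)))
      (0\<^sub>m (n + nk) nc) (closed_loop A B2 C2 K)"
    using dims by (simp add: Let_def closed_loop_def)
  moreover have "stable_mat \<dots>"
  proof (rule stable_four_block_upper[OF assms(1) _ assms(2)[unfolded stabilizes_def]])
    show "closed_loop A B2 C2 K \<in> carrier_mat (n + nk) (n + nk)"
      using carriers by (intro closed_loop_carrier) auto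
  qed (rule carrier_matI; simp add: dims)+
  ultimately show ?thesis by simp
qed

lemma resolvent_equations:
  fixes xc xh q1 q2 q3 y rc rh :: "complex vec"
  assumes v: "xc \<in> carrier_vec nc" "xh \<in> carrier_vec n"
      "q1 \<in> carrier_vec nc" "q2 \<in> carrier_vec n" "q3 \<in> carrier_vec nk" "y \<in> carrier_vec p"
    and r: "rc \<in> carrier_vec nc" "rh \<in> carrier_vec n"
    and X: "X = xc @\<^sub>v xh @\<^sub>v q1 @\<^sub>v q2 @\<^sub>v q3"
    and eq: "s \<cdot>\<^sub>v X = cmat (sysA KCQ) *\<^sub>v X + cmat (sysB KCQ) *\<^sub>v y
      + (rc @\<^sub>v rh @\<^sub>v 0\<^sub>v nc @\<^sub>v 0\<^sub>v n @\<^sub>v 0\<^sub>v nk)"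
    and f: "f = cmat C2 *\<^sub>v xh - y" and g: "g = cmat C2 *\<^sub>v q2 - f"
    and k: "k = cmat Ck *\<^sub>v q3 + cmat Dk *\<^sub>v g"
    and u: "u = (cmat Cc *\<^sub>v xc + cmat Dc *\<^sub>v y) + (k - cmat Cc *\<^sub>v q1 - cmat Dc *\<^sub>v g)"
  shows "s \<cdot>\<^sub>v xc = cmat Ac *\<^sub>v xc + cmat Bc *\<^sub>v y
      + cmat Lc *\<^sub>v (cmat Cc *\<^sub>v xc + cmat Dc *\<^sub>v y - u) + rc"
    and "s \<cdot>\<^sub>v xh = cmat A *\<^sub>v xh + cmat B2 *\<^sub>v u + cmat L *\<^sub>v f + rh"
    and "s \<cdot>\<^sub>v q1 = cmat Ac *\<^sub>v q1 + cmat Bc *\<^sub>v g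
      - cmat Lc *\<^sub>v (k - cmat Cc *\<^sub>v q1 - cmat Dc *\<^sub>v g)"
    and "s \<cdot>\<^sub>v q2 = cmat A *\<^sub>v q2 + cmat B2 *\<^sub>v k + cmat L *\<^sub>v f"
    and "s \<cdot>\<^sub>v q3 = cmat Ak *\<^sub>v q3 + cmat Bk *\<^sub>v g"
proof -
  define a1 a2 a3 a4 a5 where a:
    "a1 = cmat Ac *\<^sub>v xc + cmat Bc *\<^sub>v y + cmat Lc *\<^sub>v (cmat Cc *\<^sub>v xc + cmat Dc *\<^sub>v y - u)"
    "a2 = cmat A *\<^sub>v xh + cmat B2 *\<^sub>v u + cmat L *\<^sub>v f"
    "a3 = cmat Ac *\<^sub>v q1 + cmat Bc *\<^sub>v g - cmat Lc *\<^sub>v (k - cmat Cc *\<^sub>v q1 - cmat Dc *\<^sub>v g)"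
    "a4 = cmat A *\<^sub>v q2 + cmat B2 *\<^sub>v k + cmat L *\<^sub>v f"
    "a5 = cmat Ak *\<^sub>v q3 + cmat Bk *\<^sub>v g"
  have ca: "dim_vec a1 = nc" "dim_vec a2 = n" "dim_vec a3 = nc" "dim_vec a4 = n" "dim_vec a5 = nk"
    unfolding a by (simp_all add: dims)
  have "s \<cdot>\<^sub>v X = (a1 @\<^sub>v a2 @\<^sub>v a3 @\<^sub>v a4 @\<^sub>v a5) + (rc @\<^sub>v rh @\<^sub>v 0\<^sub>v nc @\<^sub>v 0\<^sub>v n @\<^sub>v 0\<^sub>v nk)"
    using eq unfolding X KCQ_equations(1)[OF v f g k u] a .
  also have "\<dots> = (a1 + rc) @\<^sub>v (a2 + rh) @\<^sub>v a3 @\<^sub>v a4 @\<^sub>v a5"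
    using r ca by (intro eq_vecI) auto
  finally have eqs: "(s \<cdot>\<^sub>v xc) @\<^sub>v (s \<cdot>\<^sub>v xh) @\<^sub>v (s \<cdot>\<^sub>v q1) @\<^sub>v (s \<cdot>\<^sub>v q2) @\<^sub>v (s \<cdot>\<^sub>v q3)
      = (a1 + rc) @\<^sub>v (a2 + rh) @\<^sub>v a3 @\<^sub>v a4 @\<^sub>v a5"
    unfolding X smult_append_vec .
  note 1 = append_vec_eqD[OF eqs]
  have e1: "s \<cdot>\<^sub>v xc = a1 + rc" using 1(1) v r ca by simp
  note 2 = append_vec_eqD[OF 1(2)]
  have e2: "s \<cdot>\<^sub>v xh = a2 + rh" using 2(1) v r ca by simp
  note 3 = append_vec_eqD[OF 2(2)]
  have e3: "s \<cdot>\<^sub>v q1 = a3" using 3(1) v r ca by simp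
  note 4 = append_vec_eqD[OF 3(2)]
  have e4: "s \<cdot>\<^sub>v q2 = a4" using 4(1) v r ca by simp
  have e5: "s \<cdot>\<^sub>v q3 = a5" using 4(2) v r ca by simp
  show "s \<cdot>\<^sub>v xc = cmat Ac *\<^sub>v xc + cmat Bc *\<^sub>v y
      + cmat Lc *\<^sub>v (cmat Cc *\<^sub>v xc + cmat Dc *\<^sub>v y - u) + rc"
    and "s \<cdot>\<^sub>v xh = cmat A *\<^sub>v xh + cmat B2 *\<^sub>v u + cmat L *\<^sub>v f + rh"
    and "s \<cdot>\<^sub>v q1 = cmat Ac *\<^sub>v q1 + cmat Bc *\<^sub>v g
      - cmat Lc *\<^sub>v (k - cmat Cc *\<^sub>v q1 - cmat Dc *\<^sub>v g)"
    and "s \<cdot>\<^sub>v q2 = cmat A *\<^sub>v q2 + cmat B2 *\<^sub>v k + cmat L *\<^sub>v f"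
    and "s \<cdot>\<^sub>v q3 = cmat Ak *\<^sub>v q3 + cmat Bk *\<^sub>v g"
    using e1 e2 e3 e4 e5 unfolding a .
qed

lemma difference_dynamics:
  fixes xc xh q1 q2 q3 y rc rh :: "complex vec"
  assumes v: "xc \<in> carrier_vec nc" "xh \<in> carrier_vec n"
      "q1 \<in> carrier_vec nc" "q2 \<in> carrier_vec n" "q3 \<in> carrier_vec nk" "y \<in> carrier_vec p"
    and r: "rc \<in> carrier_vec nc" "rh \<in> carrier_vec n"
    and X: "X = xc @\<^sub>v xh @\<^sub>v q1 @\<^sub>v q2 @\<^sub>v q3"
    and eq: "s \<cdot>\<^sub>v X = cmat (sysA KCQ) *\<^sub>v X + cmat (sysB KCQ) *\<^sub>v y
      + (rc @\<^sub>v rh @\<^sub>v 0\<^sub>v nc @\<^sub>v 0\<^sub>v n @\<^sub>v 0\<^sub>v nk)"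
  defines "w \<equiv> (xh - q2) @\<^sub>v (xc - q1)"
  shows "s \<cdot>\<^sub>v w = cmat (closed_loop A B2 C2 C) *\<^sub>v w + (rh @\<^sub>v rc)"
proof -
  define f where "f = cmat C2 *\<^sub>v xh - y"
  define g where "g = cmat C2 *\<^sub>v q2 - f"
  define k where "k = cmat Ck *\<^sub>v q3 + cmat Dk *\<^sub>v g"
  define u where "u = (cmat Cc *\<^sub>v xc + cmat Dc *\<^sub>v y) + (k - cmat Cc *\<^sub>v q1 - cmat Dc *\<^sub>v g)"
  define h where "h = xh - q2"
  define z where "z = xc - q1"
  note eqs = resolvent_equations[OF v r X eq f_def g_def k_def u_def]
  have hz: "h \<in> carrier_vec n" "z \<in> carrier_vec nc" unfolding h_def z_def using v by auto
  have fdims: "dim_vec f = p" "dim_vec g = p" "dim_vec k = m" "dim_vec u = m"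
    unfolding f_def g_def k_def u_def using v by (simp_all add: dims)
  have yg: "cmat C2 *\<^sub>v h = y - g"
    unfolding h_def g_def f_def using v
    by (intro eq_vecI) (simp_all add: mat_vec_linear dims)
  have uk: "cmat Cc *\<^sub>v z + cmat Dc *\<^sub>v (cmat C2 *\<^sub>v h) = u - k"
    unfolding yg u_def z_def using v fdims
    by (intro eq_vecI) (simp_all add: mat_vec_linear dims)
  have s_h: "s \<cdot>\<^sub>v h = (cmat A *\<^sub>v h + cmat B2 *\<^sub>v (u - k)) + rh"
    unfolding h_def using v r fdims
    by (intro eq_vecI) (simp_all add: smult_minus_vec eqs(2,4) mat_vec_linear dims)
  define t where "t = k - cmat Cc *\<^sub>v q1 - cmat Dc *\<^sub>v g"
  have t: "dim_vec t = m" unfolding t_def by (simp add: dims)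
  have "cmat Cc *\<^sub>v xc + cmat Dc *\<^sub>v y - u = 0\<^sub>v m - t"
    unfolding u_def t_def[symmetric] using v t by (intro eq_vecI) (simp_all add: dims)
  then have Lcu: "cmat Lc *\<^sub>v (cmat Cc *\<^sub>v xc + cmat Dc *\<^sub>v y - u) = 0\<^sub>v nc - cmat Lc *\<^sub>v t"
    using t by (simp add: mult_mat_minus_vec dims)
  have s_z: "s \<cdot>\<^sub>v z = (cmat Ac *\<^sub>v z + cmat Bc *\<^sub>v (y - g)) + rc"
    unfolding z_def using v r fdims t
    by (intro eq_vecI) (simp_all add: smult_minus_vec eqs(1,3)[unfolded Lcu, folded t_def] mat_vec_linear dims)
  have "cmat (closed_loop A B2 C2 C) *\<^sub>v (h @\<^sub>v z) =
      (cmat A *\<^sub>v h + cmat B2 *\<^sub>v (u - k)) @\<^sub>v (cmat Ac *\<^sub>v z + cmat Bc *\<^sub>v (y - g))"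
    using closed_loop_mult_vec[OF plant, of C, unfolded system.sel, OF ctrl_C hz yg[symmetric]]
    unfolding uk[unfolded yg] .
  then show ?thesis
    unfolding w_def h_def[symmetric] z_def[symmetric] smult_append_vec s_h s_z
    using hz r by (intro eq_vecI) (auto simp: dims)
qed

text \<open>The case \<open>q\<^sub>1 = x\<^sub>c\<close>, \<open>q\<^sub>2 = xhat\<close>, in which \<open>C\<^sub>2 q\<^sub>2 - f = y\<close> drives the
  \<open>q\<^sub>3\<close> block.\<close>

lemma zero_difference_dynamics:
  fixes xc xh q3 y :: "complex vec"
  assumes v: "xc \<in> carrier_vec nc" "xh \<in> carrier_vec n" "q3 \<in> carrier_vec nk" "y \<in> carrier_vec p"
    and X: "X = xc @\<^sub>v xh @\<^sub>v xc @\<^sub>v xh @\<^sub>v q3"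
    and eq: "s \<cdot>\<^sub>v X = cmat (sysA KCQ) *\<^sub>v X + cmat (sysB KCQ) *\<^sub>v y"
    and u: "u = cmat Ck *\<^sub>v q3 + cmat Dk *\<^sub>v y"
  shows "s \<cdot>\<^sub>v q3 = cmat Ak *\<^sub>v q3 + cmat Bk *\<^sub>v y"
    and "cmat (sysC KCQ) *\<^sub>v X + cmat (sysD KCQ) *\<^sub>v y = u"
    and "s \<cdot>\<^sub>v xh = cmat A *\<^sub>v xh + cmat B2 *\<^sub>v u + cmat L *\<^sub>v (cmat C2 *\<^sub>v xh - y)"
    and "s \<cdot>\<^sub>v xc = cmat Ac *\<^sub>v xc + cmat Bc *\<^sub>v y
      - cmat Lc *\<^sub>v (u - cmat Cc *\<^sub>v xc - cmat Dc *\<^sub>v y)"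
proof -
  have g: "y = cmat C2 *\<^sub>v xh - (cmat C2 *\<^sub>v xh - y)"
    using v by (intro eq_vecI) (simp_all add: dims)
  have u': "u = (cmat Cc *\<^sub>v xc + cmat Dc *\<^sub>v y) + (u - cmat Cc *\<^sub>v xc - cmat Dc *\<^sub>v y)"
    unfolding u using v by (intro eq_vecI) (simp_all add: dims)
  have eq': "s \<cdot>\<^sub>v X = cmat (sysA KCQ) *\<^sub>v X + cmat (sysB KCQ) *\<^sub>v y
      + (0\<^sub>v nc @\<^sub>v 0\<^sub>v n @\<^sub>v 0\<^sub>v nc @\<^sub>v 0\<^sub>v n @\<^sub>v 0\<^sub>v nk)"
    unfolding eq zero_append_zero_vec using v
    by (intro eq_vecI) (simp_all add: KCQ_dims del: composite.simps parameter_Q.simps)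
  note eqs = resolvent_equations[OF v(1,2,1,2,3,4) zero_carrier_vec zero_carrier_vec X eq' refl g u u']
  show "s \<cdot>\<^sub>v q3 = cmat Ak *\<^sub>v q3 + cmat Bk *\<^sub>v y" by (rule eqs(5))
  show "cmat (sysC KCQ) *\<^sub>v X + cmat (sysD KCQ) *\<^sub>v y = u"
    unfolding X by (rule KCQ_equations(2)[OF v(1,2,1,2,3,4) refl g u u'])
  show "s \<cdot>\<^sub>v xh = cmat A *\<^sub>v xh + cmat B2 *\<^sub>v u + cmat L *\<^sub>v (cmat C2 *\<^sub>v xh - y)" by (rule eqs(4))
  show "s \<cdot>\<^sub>v xc = cmat Ac *\<^sub>v xc + cmat Bc *\<^sub>v y
      - cmat Lc *\<^sub>v (u - cmat Cc *\<^sub>v xc - cmat Dc *\<^sub>v y)" by (rule eqs(3))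
qed

lemma plant_closed_loop_carrier: "closed_loop A B2 C2 C \<in> carrier_mat (n + nc) (n + nc)"
  "closed_loop A B2 C2 K \<in> carrier_mat (n + nk) (n + nk)"
  using closed_loop_carrier[OF plant, of C nc] closed_loop_carrier[OF plant, of K nk] carriers
  by simp_all

lemma KCQ_state_splitE:
  assumes "X \<in> carrier_vec (nc + (n + (nc + (n + nk))))"
  obtains xc xh q1 q2 q3 where "xc \<in> carrier_vec nc" "xh \<in> carrier_vec n"
    "q1 \<in> carrier_vec nc" "q2 \<in> carrier_vec n" "q3 \<in> carrier_vec nk"
    "X = xc @\<^sub>v xh @\<^sub>v q1 @\<^sub>v q2 @\<^sub>v q3"
  using assms by (metis carrier_vec_splitE)

lemma difference_vanishes:
  fixes X y :: "complex vec"
  assumes X: "X \<in> carrier_vec (nc + (n + (nc + (n + nk))))" and y: "y \<in> carrier_vec p"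
    and eq: "s \<cdot>\<^sub>v X = cmat (sysA KCQ) *\<^sub>v X + cmat (sysB KCQ) *\<^sub>v y"
    and s: "\<not> eigenvalue (cmat (closed_loop A B2 C2 C)) s"
  obtains xc xh q3 where "xc \<in> carrier_vec nc" "xh \<in> carrier_vec n" "q3 \<in> carrier_vec nk"
    "X = xc @\<^sub>v xh @\<^sub>v xc @\<^sub>v xh @\<^sub>v q3"
proof -
  obtain xc xh q1 q2 q3 where v: "xc \<in> carrier_vec nc" "xh \<in> carrier_vec n"
    "q1 \<in> carrier_vec nc" "q2 \<in> carrier_vec n" "q3 \<in> carrier_vec nk"
    and X': "X = xc @\<^sub>v xh @\<^sub>v q1 @\<^sub>v q2 @\<^sub>v q3"
    using KCQ_state_splitE[OF X] .
  let ?w = "(xh - q2) @\<^sub>v (xc - q1)"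
  have w: "?w \<in> carrier_vec (n + nc)" using v by auto
  have eq': "s \<cdot>\<^sub>v X = cmat (sysA KCQ) *\<^sub>v X + cmat (sysB KCQ) *\<^sub>v y
      + (0\<^sub>v nc @\<^sub>v 0\<^sub>v n @\<^sub>v 0\<^sub>v nc @\<^sub>v 0\<^sub>v n @\<^sub>v 0\<^sub>v nk)"
    unfolding eq zero_append_zero_vec
    by (intro eq_vecI) (simp_all add: KCQ_dims del: composite.simps parameter_Q.simps)
  have "s \<cdot>\<^sub>v ?w = cmat (closed_loop A B2 C2 C) *\<^sub>v ?w + (0\<^sub>v n @\<^sub>v 0\<^sub>v nc)"
    by (rule difference_dynamics[OF v y zero_carrier_vec zero_carrier_vec X' eq'])
  also have "\<dots> = cmat (closed_loop A B2 C2 C) *\<^sub>v ?w"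
    unfolding zero_append_zero_vec using plant_closed_loop_carrier(1) by (intro eq_vecI) auto
  finally have "?w = 0\<^sub>v (n + nc)"
    using s w plant_closed_loop_carrier(1) unfolding eigenvalue_def eigenvector_def by force
  then have "?w = 0\<^sub>v n @\<^sub>v 0\<^sub>v nc" by (simp add: zero_append_zero_vec)
  from append_vec_eqD[OF this] have "xh - q2 = 0\<^sub>v n" "xc - q1 = 0\<^sub>v nc" using v by simp_all
  then have "xh = q2" "xc = q1" using v minus_vec_eqD by fastforce+
  then show thesis using that v X' by blast
qed

lemma KCQ_stabilizes:
  assumes stab: "stabilizes A B2 C2 C" "stabilizes A B2 C2 K"
    and L: "stable_mat (A + L * C2)" and Lc: "stable_mat (Ac + Lc * Cc)"
  shows "stabilizes A B2 C2 KCQ"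
  unfolding stabilizes_def
proof (rule stable_matI[OF closed_loop_carrier[OF plant KCQ_carriers(1)]])
  let ?N = "nc + (n + (nc + (n + nk)))"
  fix s v assume vc: "v \<in> carrier_vec (n + ?N)" and s: "0 \<le> Re s"
    and eq: "cmat (closed_loop A B2 C2 KCQ) *\<^sub>v v = s \<cdot>\<^sub>v v"
  obtain x X where x: "x \<in> carrier_vec n" and X: "X \<in> carrier_vec ?N" and v: "v = x @\<^sub>v X"
    using carrier_vec_splitE[OF vc] .
  define y where "y = cmat C2 *\<^sub>v x"
  have y: "y \<in> carrier_vec p" unfolding y_def by (rule carrier_vecI) (simp add: dims)
  define u where "u = cmat (sysC KCQ) *\<^sub>v X + cmat (sysD KCQ) *\<^sub>v y"
  have "(cmat A *\<^sub>v x + cmat B2 *\<^sub>v u) @\<^sub>v (cmat (sysA KCQ) *\<^sub>v X + cmat (sysB KCQ) *\<^sub>v y)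
      = (s \<cdot>\<^sub>v x) @\<^sub>v (s \<cdot>\<^sub>v X)"
    using eq closed_loop_mult_vec[OF plant KCQ_carriers x X y_def]
    unfolding v smult_append_vec u_def by metis
  from append_vec_eqD[OF this] have ev_x: "cmat A *\<^sub>v x + cmat B2 *\<^sub>v u = s \<cdot>\<^sub>v x"
    and ev_X: "s \<cdot>\<^sub>v X = cmat (sysA KCQ) *\<^sub>v X + cmat (sysB KCQ) *\<^sub>v y"
    using x by (simp_all add: dims del: composite.simps parameter_Q.simps)
  have "\<not> eigenvalue (cmat (closed_loop A B2 C2 C)) s"
    using stab(1) s unfolding stabilizes_def stable_mat_def by force
  from difference_vanishes[OF X y ev_X this] obtain xc xh q3 where
    c: "xc \<in> carrier_vec nc" "xh \<in> carrier_vec n" "q3 \<in> carrier_vec nk"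
    and X': "X = xc @\<^sub>v xh @\<^sub>v xc @\<^sub>v xh @\<^sub>v q3" .
  note red = zero_difference_dynamics[OF c y X' ev_X refl]
  have u: "u = cmat Ck *\<^sub>v q3 + cmat Dk *\<^sub>v y" unfolding u_def by (rule red(2))
  have "cmat (closed_loop A B2 C2 K) *\<^sub>v (x @\<^sub>v q3) = s \<cdot>\<^sub>v (x @\<^sub>v q3)"
    using closed_loop_mult_vec[OF plant, of K, unfolded system.sel, OF ctrl_K x c(3) y_def]
    unfolding u[symmetric] ev_x red(1)[symmetric] smult_append_vec .
  then have "x @\<^sub>v q3 = 0\<^sub>v (n + nk)"
    using stable_mat_eigenvector_zero[OF stab(2)[unfolded stabilizes_def] plant_closed_loop_carrier(2) _ _ s]
      x c(3) by auto
  then have "x @\<^sub>v q3 = 0\<^sub>v n @\<^sub>v 0\<^sub>v nk" by (simp add: zero_append_zero_vec)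
  from append_vec_eqD[OF this] have x0: "x = 0\<^sub>v n" and q3: "q3 = 0\<^sub>v nk" using x by simp_all
  have y0: "y = 0\<^sub>v p" unfolding y_def x0 by (simp add: dims)
  have k0: "cmat Ck *\<^sub>v q3 + cmat Dk *\<^sub>v y = 0\<^sub>v m" unfolding q3 y0 by (simp add: dims)
  have "s \<cdot>\<^sub>v xh = cmat (A + L * C2) *\<^sub>v xh"
    unfolding cmat_add_mult_mult_vec[OF plant(1) gains(1) plant(3) c(2)]
    unfolding red(3)[unfolded k0, unfolded y0] using c
    by (intro eq_vecI) (simp_all add: mat_vec_linear dims)
  then have xh: "xh = 0\<^sub>v n"
    using stable_mat_eigenvector_zero[OF L _ c(2) _ s] carriers by auto
  have "s \<cdot>\<^sub>v xc = cmat (Ac + Lc * Cc) *\<^sub>v xc"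
    unfolding cmat_add_mult_mult_vec[OF ctrl_C(1) gains(2) ctrl_C(3) c(1)]
    unfolding red(4)[unfolded k0, unfolded y0] using c
    by (intro eq_vecI) (simp_all add: mat_vec_linear dims)
  then have xc: "xc = 0\<^sub>v nc"
    using stable_mat_eigenvector_zero[OF Lc _ c(1) _ s] carriers by auto
  show "v = 0\<^sub>v (n + ?N)" unfolding v X' x0 xh xc q3 zero_append_zero_vec ..
qed

text \<open>The differences form an autonomous quotient of the controller dynamics with the state matrix
  of the loop around \<open>C\<close>, so surjectivity of the resolvent passes to that loop.\<close>

lemma KCQ_resolvent_imp_loop_resolvent:
  assumes s: "\<not> eigenvalue (cmat (sysA KCQ)) s"
  shows "\<not> eigenvalue (cmat (closed_loop A B2 C2 C)) s"
proof (rule not_eigenvalueI)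
  show "cmat (closed_loop A B2 C2 C) \<in> carrier_mat (n + nc) (n + nc)"
    using plant_closed_loop_carrier(1) by simp
  fix r :: "complex vec" assume "r \<in> carrier_vec (n + nc)"
  then obtain rh rc where r: "rh \<in> carrier_vec n" "rc \<in> carrier_vec nc" "r = rh @\<^sub>v rc"
    by (elim carrier_vec_splitE)
  let ?N = "nc + (n + (nc + (n + nk)))"
  let ?r = "rc @\<^sub>v rh @\<^sub>v 0\<^sub>v nc @\<^sub>v 0\<^sub>v n @\<^sub>v 0\<^sub>v nk"
  have N: "cmat (sysA KCQ) \<in> carrier_mat ?N ?N" and r': "?r \<in> carrier_vec ?N"
    using KCQ_carriers(1) r by (simp_all del: composite.simps parameter_Q.simps)
  obtain X where X: "X \<in> carrier_vec ?N" and eq: "s \<cdot>\<^sub>v X = cmat (sysA KCQ) *\<^sub>v X + ?r"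
    using resolvent_solution[OF N s r'] .
  obtain xc xh q1 q2 q3 where v: "xc \<in> carrier_vec nc" "xh \<in> carrier_vec n"
    "q1 \<in> carrier_vec nc" "q2 \<in> carrier_vec n" "q3 \<in> carrier_vec nk"
    and X': "X = xc @\<^sub>v xh @\<^sub>v q1 @\<^sub>v q2 @\<^sub>v q3"
    using KCQ_state_splitE[OF X] .
  have "cmat (sysA KCQ) *\<^sub>v X + cmat (sysB KCQ) *\<^sub>v 0\<^sub>v p = cmat (sysA KCQ) *\<^sub>v X"
    by (intro eq_vecI) (simp_all add: KCQ_dims del: composite.simps parameter_Q.simps)
  then have eq': "s \<cdot>\<^sub>v X = cmat (sysA KCQ) *\<^sub>v X + cmat (sysB KCQ) *\<^sub>v 0\<^sub>v p + ?r"
    using eq by metis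
  have "s \<cdot>\<^sub>v ((xh - q2) @\<^sub>v (xc - q1)) =
      cmat (closed_loop A B2 C2 C) *\<^sub>v ((xh - q2) @\<^sub>v (xc - q1)) + r"
    unfolding r(3) by (rule difference_dynamics[OF v zero_carrier_vec r(2,1) X' eq'])
  moreover have "(xh - q2) @\<^sub>v (xc - q1) \<in> carrier_vec (n + nc)" using v by auto
  ultimately show "\<exists>w \<in> carrier_vec (n + nc). s \<cdot>\<^sub>v w = cmat (closed_loop A B2 C2 C) *\<^sub>v w + r"
    by blast
qed

lemma KCQ_transfer_mat:
  assumes s: "\<not> eigenvalue (cmat (sysA KCQ)) s" "\<not> eigenvalue (cmat Ak) s"
  shows "transfer_mat KCQ s = transfer_mat K s"
proof (rule eq_mat_mult_vecI)
  show "transfer_mat KCQ s \<in> carrier_mat m p" by (rule transfer_mat_carrier[OF KCQ_carriers])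
  show "transfer_mat K s \<in> carrier_mat m p"
    using ctrl_K by (intro transfer_mat_carrier) auto
  fix y :: "complex vec" assume y: "y \<in> carrier_vec p"
  let ?N = "nc + (n + (nc + (n + nk)))"
  have N: "cmat (sysA KCQ) \<in> carrier_mat ?N ?N" and By: "cmat (sysB KCQ) *\<^sub>v y \<in> carrier_vec ?N"
    using KCQ_carriers(1,2) y by (auto simp del: composite.simps parameter_Q.simps)
  obtain X where X: "X \<in> carrier_vec ?N"
    and eq: "s \<cdot>\<^sub>v X = cmat (sysA KCQ) *\<^sub>v X + cmat (sysB KCQ) *\<^sub>v y"
    using resolvent_solution[OF N s(1) By] .
  obtain xc xh q3 where v: "xc \<in> carrier_vec nc" "xh \<in> carrier_vec n" "q3 \<in> carrier_vec nk"
    and X': "X = xc @\<^sub>v xh @\<^sub>v xc @\<^sub>v xh @\<^sub>v q3"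
    using difference_vanishes[OF X y eq KCQ_resolvent_imp_loop_resolvent[OF s(1)]] .
  note red = zero_difference_dynamics[OF v y X' eq refl]
  have "transfer_mat KCQ s *\<^sub>v y = cmat Ck *\<^sub>v q3 + cmat Dk *\<^sub>v y"
    using transfer_mat_mult_vec[OF KCQ_carriers s(1) X y eq] red(2) by (rule trans)
  also have "\<dots> = transfer_mat K s *\<^sub>v y"
    using transfer_mat_mult_vec[of K, unfolded system.sel, OF ctrl_K s(2) v(3) y red(1)] ..
  finally show "transfer_mat KCQ s *\<^sub>v y = transfer_mat K s *\<^sub>v y" .
qed

end

theorem proposition1:
  fixes n m p nc nk :: nat
    and A B2 C2 Ac Bc Cc Dc Ak Bk Ck Dk L Lc :: "real mat"
    and C K Q KCQ :: system
  assumes "A \<in> carrier_mat n n" and "B2 \<in> carrier_mat n m" and "C2 \<in> carrier_mat p n"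
    and "stabilizable A B2" and "detectable C2 A"
    and "Ac \<in> carrier_mat nc nc" and "Bc \<in> carrier_mat nc p"
    and "Cc \<in> carrier_mat m nc" and "Dc \<in> carrier_mat m p"
    and "Ak \<in> carrier_mat nk nk" and "Bk \<in> carrier_mat nk p"
    and "Ck \<in> carrier_mat m nk" and "Dk \<in> carrier_mat m p"
    and "C = System Ac Bc Cc Dc" and "K = System Ak Bk Ck Dk"
    and "stabilizes A B2 C2 C" and "stabilizes A B2 C2 K"
    and "L \<in> carrier_mat n p" and "Lc \<in> carrier_mat nc m"
    and "stable_mat (A + L * C2)" and "stable_mat (Ac + Lc * Cc)"
    and "Q = parameter_Q A B2 C2 L Lc C K"
    and "KCQ = composite A B2 C2 L Lc C Q"
  shows "stable_mat (sysA Q)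
    \<and> stabilizes A B2 C2 KCQ
    \<and> (\<forall>s::complex. \<not> eigenvalue (cmat (sysA KCQ)) s \<and> \<not> eigenvalue (cmat Ak) s
         \<longrightarrow> transfer_mat KCQ s = transfer_mat K s)"
proof -
  interpret two_controllers n m p nc nk A B2 C2 L Lc Ac Bc Cc Dc Ak Bk Ck Dk
    by unfold_locales fact+
  note CK = \<open>C = System Ac Bc Cc Dc\<close> \<open>K = System Ak Bk Ck Dk\<close>
  note stab = \<open>stabilizes A B2 C2 C\<close>[unfolded CK] \<open>stabilizes A B2 C2 K\<close>[unfolded CK]
  show ?thesis
    unfolding \<open>KCQ = composite A B2 C2 L Lc C Q\<close> \<open>Q = parameter_Q A B2 C2 L Lc C K\<close> CK
    using Q_stable[OF \<open>stable_mat (Ac + Lc * Cc)\<close> stab(2)] KCQ_transfer_mat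
      KCQ_stabilizes[OF stab \<open>stable_mat (A + L * C2)\<close> \<open>stable_mat (Ac + Lc * Cc)\<close>]
    by blast
qed

end
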